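(* Let $n\ge 2$ be an integer. Let $\mathfrak A$ and $\mathfrak A'$ be two $C^*$-algebras with identities $I_{\mathfrak A}$ and $I_{\mathfrak A'}$, respectively, and let $P_1$ and $P_2=I_{\mathfrak A}-P_1$ be nontrivial symmetric projections in $\mathfrak A$. Suppose that for each $j\in\{1,2\}$ and each $X\in\mathfrak A$, $P_j\mathfrak A X=\{0\}$ implies $X=0$. Suppose moreover that $\varphi:\mathfrak A\to\mathfrak A'$ is a bijective unital map (not assumed additive) that preserves complex scalar multiplication and such that for each $j\in\{1,2\}$ and each $Y\in\mathfrak A'$, $\varphi(P_j)\mathfrak A'Y=\{0\}$ implies $Y=0$. Then $\varphi$ is a multiplicative $*$-Lie $n$-map if and only if $\varphi$ is a $*$-isomorphism.
   Context: For elements $x,y$ of a $*$-algebra, $[x,y]_*=xy-yx^*$. The polynomials $p_{n_*}$ are defined by $p_{1_*}(x)=x$ and $p_{n_*}(x_1,\ldots,x_n)=[p_{(n-1)_*}(x_1,\ldots,x_{n-1}),x_n]_*$ for $n\ge 2$. A map $\varphi$ (not necessarily additive) is a multiplicative $*$-Lie $n$-map if $\varphi(p_{n_*}(x_1,\ldots,x_n))=p_{n_*}(\varphi(x_1),\ldots,\varphi(x_n))$ for all $x_1,\ldots,x_n$ in its domain. A symmetric projection is an element $P$ with $P^2=P=P^*$; nontrivial means different from $0$ and the identity. Unital means $\varphi(I_{\mathfrak A})=I_{\mathfrak A'}$. Preserving complex scalar multiplication means $\varphi(\lambda A)=\lambda\varphi(A)$ for all $\lambda\in\mathbb C$, $A\in\mathfrak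 A$. A $*$-isomorphism is a bijective complex-linear multiplicative map preserving $*$. *)

theory Defs
  imports Complex_Main
begin

text \<open>
  Unital C*-algebras. The real normed structure comes from the library classes, completeness
  from \<^class>\<open>banach\<close>; the axiom \<open>scaleR_scaleC\<close> makes it the restriction of the complex one.
  The zero algebra is excluded by \<open>0 \<noteq> 1\<close>; in any other unital C*-algebra the inherited axiom
  \<open>norm 1 = 1\<close> follows from the C*-identity.
\<close>

class unital_cstar_algebra = real_normed_algebra_1 + banach +
  fixes scaleC :: "complex \<Rightarrow> 'a \<Rightarrow> 'a" (infixr "*\<^sub>C" 75)
    and star :: "'a \<Rightarrow> 'a"
  assumes scaleR_scaleC: "scaleR r x = complex_of_real r *\<^sub>C x"
    and scaleC_add_right: "a *\<^sub>C (x + y) = a *\<^sub>C x + a *\<^sub>C y"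
    and scaleC_add_left: "(a + b) *\<^sub>C x = a *\<^sub>C x + b *\<^sub>C x"
    and scaleC_scaleC: "a *\<^sub>C (b *\<^sub>C x) = (a * b) *\<^sub>C x"
    and scaleC_one: "1 *\<^sub>C x = x"
    and mult_scaleC_left: "(a *\<^sub>C x) * y = a *\<^sub>C (x * y)"
    and mult_scaleC_right: "x * (a *\<^sub>C y) = a *\<^sub>C (x * y)"
    and norm_scaleC: "norm (a *\<^sub>C x) = cmod a * norm x"
    and star_add: "star (x + y) = star x + star y"
    and star_scaleC: "star (a *\<^sub>C x) = cnj a *\<^sub>C star x"
    and star_mult: "star (x * y) = star y * star x"
    and star_star: "star (star x) = x"
    and cstar_identity: "norm (star x * x) = (norm x)\<^sup>2"

definition star_lie_product :: "'a::unital_cstar_algebra \<Rightarrow> 'a \<Rightarrow> 'a" where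
  "star_lie_product x y = x * y - y * star x"

text \<open>
  A tuple \<open>(x\<^sub>1, \<dots>, x\<^sub>n)\<close> is a function on \<^typ>\<open>nat\<close> of which only the values at \<open>1, \<dots>, n\<close>
  are used. The value for \<open>n = 0\<close> is a dummy.
\<close>

fun star_lie_poly :: "nat \<Rightarrow> (nat \<Rightarrow> 'a::unital_cstar_algebra) \<Rightarrow> 'a" where
  "star_lie_poly 0 x = 0"
| "star_lie_poly (Suc 0) x = x 1"
| "star_lie_poly (Suc (Suc k)) x =
     star_lie_product (star_lie_poly (Suc k) x) (x (Suc (Suc k)))"

definition multiplicative_star_lie_map ::
    "nat \<Rightarrow> ('a::unital_cstar_algebra \<Rightarrow> 'b::unital_cstar_algebra) \<Rightarrow> bool" where
  "multiplicative_star_lie_map n \<phi> \<longleftrightarrow>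
     (\<forall>x. \<phi> (star_lie_poly n x) = star_lie_poly n (\<lambda>i. \<phi> (x i)))"

definition symmetric_projection :: "'a::unital_cstar_algebra \<Rightarrow> bool" where
  "symmetric_projection P \<longleftrightarrow> P * P = P \<and> star P = P"

definition nontrivial_symmetric_projection :: "'a::unital_cstar_algebra \<Rightarrow> bool" where
  "nontrivial_symmetric_projection P \<longleftrightarrow> symmetric_projection P \<and> P \<noteq> 0 \<and> P \<noteq> 1"

definition star_isomorphism ::
    "('a::unital_cstar_algebra \<Rightarrow> 'b::unital_cstar_algebra) \<Rightarrow> bool" where
  "star_isomorphism \<phi> \<longleftrightarrow>
     bij \<phi> \<and>
     (\<forall>x y. \<phi> (x + y) = \<phi> x + \<phi> y) \<and>
     (\<forall>a x. \<phi> (a *\<^sub>C x) = a *\<^sub>C \<phi> x) \<and>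
     (\<forall>x y. \<phi> (x * y) = \<phi> x * \<phi> y) \<and>
     (\<forall>x. \<phi> (star x) = star (\<phi> x))"

end

theory Submission
  imports Defs
begin

text \<open>
  A \<open>*\<close>-isomorphism preserves every polynomial built from \<open>[x, y]\<^sub>* = x y - y x\<^sup>*\<close>, so the
  content is the converse. Two preliminary steps turn the \<open>n\<close>-fold identity into algebra that is
  easy to handle.

  \<^item> The element \<open>\<i> 1\<close> acts as an invertible scalar: \<open>[\<i> r 1, y]\<^sub>* = 2 \<i> r y\<close> for real \<open>r\<close>.
    Filling the first \<open>n - 2\<close> slots with \<open>\<i> 1, 1, \<dots>, 1\<close> therefore shows that \<open>\<phi>\<close> already
    preserves the binary product (\<open>multiplicative_star_lie_map_binary\<close>).
  \<^item> Replacing \<open>x\<close> by \<open>\<i> x\<close> in \<open>[x, y]\<^sub>*\<close> produces \<open>\<i> (x y + y x\<^sup>*)\<close>. Hence \<open>\<phi>\<close> preserves both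
    \<open>x y - y x\<^sup>*\<close> and \<open>x y + y x\<^sup>*\<close>, and for self-adjoint \<open>x\<close> these are the commutator and the
    Jordan product.

  If \<open>\<phi>\<close> is additive, adding the two identities gives \<open>\<phi> (2 x y) = 2 \<phi> x \<phi> y\<close>, and the second one
  with \<open>y = 1\<close> gives \<open>\<phi> (x\<^sup>*) = (\<phi> x)\<^sup>*\<close>. So everything rests on additivity.

  To prove \<open>\<phi> (a + b) = \<phi> a + \<phi> b\<close>, choose \<open>t\<close> with \<open>\<phi> t = \<phi> a + \<phi> b\<close>, which exists by
  surjectivity, and show \<open>t = a + b\<close>. Both products are additive in each argument, so
  multiplying \<open>t\<close> by a test element \<open>x\<close> multiplies \<open>a\<close> and \<open>b\<close> by \<open>x\<close> under \<open>\<phi>\<close>; if \<open>x\<close> annihilates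
  one of them, injectivity turns the relation into an equation for \<open>t\<close>. With \<open>p = P\<^sub>1\<close> and
  \<open>q = 1 - p\<close>, the test elements \<open>p\<close>, \<open>q\<close> and \<open>p - q\<close> separate the four Peirce corners
  \<open>p A p\<close>, \<open>p A q\<close>, \<open>q A p\<close>, \<open>q A q\<close>, which gives additivity across corners. Inside \<open>p A q\<close>,
  the sum \<open>a + b\<close> is the \<open>p A q\<close> component of a single product, namely that of \<open>p + a\<close> and
  \<open>q + b\<close>. Inside \<open>p A p\<close>, multiplying by elements of \<open>q A p\<close> moves the question into the corner
  \<open>q A p\<close>, where it is settled, and the hypothesis that \<open>q A x = {0}\<close> forces \<open>x = 0\<close> brings the
  answer back.
\<close>

section \<open>Involutions and projections\<close>

declare star_star [simp]

lemma scaleC_minus_one: "(-1) *\<^sub>C x = - (x::'a::unital_cstar_algebra)"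
  using scaleR_scaleC[of "-1" x] by simp

lemma star_zero [simp]: "star 0 = (0::'a::unital_cstar_algebra)"
  using star_add[of "0::'a" 0] by simp

lemma star_minus [simp]: "star (- x) = - star x"
  using star_add[of x "- x"] by (simp add: eq_neg_iff_add_eq_0 add.commute)

lemma star_diff: "star (x - y) = star x - star y"
  using star_add[of x "- y"] by simp

lemma star_one [simp]: "star 1 = (1::'a::unital_cstar_algebra)"
  using star_mult[of "star 1 :: 'a" 1] by simp

lemmas star_simps = star_add star_diff star_mult

lemma symmetric_projectionD:
  assumes "symmetric_projection p"
  shows "p * p = p" "p * (p * x) = p * x" "star p = p"
  using assms unfolding symmetric_projection_def by (auto simp: mult.assoc[symmetric])

lemma symmetric_projection_compl:
  assumes "symmetric_projection p"
  shows "symmetric_projection (1 - p)"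
  using symmetric_projectionD[OF assms]
  by (simp add: symmetric_projection_def star_simps algebra_simps)

lemma off_diagonal_absorb:
  assumes "symmetric_projection p" "c = p * d * (1 - p)"
  shows "p * c = c" "c * p = 0"
  unfolding assms(2) by (simp_all add: algebra_simps symmetric_projectionD[OF assms(1)])

lemma double_cancel: "x + x = y + y \<longleftrightarrow> x = (y::'a::unital_cstar_algebra)"
proof
  assume "x + x = y + y"
  then have "(2::real) *\<^sub>R x = 2 *\<^sub>R y" by (simp add: scaleR_2)
  then show "x = y" by simp
qed simp

section \<open>Reduction to the binary product\<close>

text \<open>
  An imaginary multiple \<open>c 1\<close> satisfies \<open>[c 1, 1]\<^sub>* = (c - cnj c) 1 = 2 c 1\<close>, so each further \<open>1\<close>
  only doubles the scalar. Starting from a real scalar would give \<open>0\<close> instead.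
\<close>

lemma star_lie_poly_imaginary_unit:
  fixes x :: "nat \<Rightarrow> 'a::unital_cstar_algebra"
  assumes "x 1 = \<i> *\<^sub>C 1" "\<And>k. 2 \<le> k \<Longrightarrow> k \<le> Suc m \<Longrightarrow> x k = 1"
  shows "star_lie_poly (Suc m) x = (2 ^ m * \<i>) *\<^sub>C 1"
  using assms(2)
proof (induction m)
  case 0
  then show ?case using assms(1) by simp
next
  case (Suc m)
  have "star_lie_poly (Suc m) x = (2 ^ m * \<i>) *\<^sub>C 1"
    using Suc by simp
  moreover have "x (Suc (Suc m)) = 1"
    using Suc.prems by simp
  ultimately have "star_lie_poly (Suc (Suc m)) x
      = (2 ^ m * \<i>) *\<^sub>C 1 + (-1) *\<^sub>C (cnj (2 ^ m * \<i>) *\<^sub>C 1)"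
    by (simp add: star_lie_product_def star_scaleC scaleC_minus_one)
  also have "\<dots> = (2 ^ m * \<i> + (-1) * cnj (2 ^ m * \<i>)) *\<^sub>C 1"
    by (simp only: scaleC_scaleC scaleC_add_left)
  also have "2 ^ m * \<i> + (-1) * cnj (2 ^ m * \<i>) = 2 ^ Suc m * \<i>"
    by simp
  finally show ?case .
qed

lemma star_lie_product_scalar:
  "star_lie_product ((of_real r * \<i>) *\<^sub>C 1) y = (2 * of_real r * \<i>) *\<^sub>C y"
proof -
  have "star_lie_product ((of_real r * \<i>) *\<^sub>C 1) y
      = (of_real r * \<i>) *\<^sub>C y + (-1) *\<^sub>C (cnj (of_real r * \<i>) *\<^sub>C y)"
    by (simp add: star_lie_product_def star_scaleC mult_scaleC_left mult_scaleC_right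
        scaleC_minus_one)
  also have "\<dots> = (of_real r * \<i> + (-1) * cnj (of_real r * \<i>)) *\<^sub>C y"
    by (simp only: scaleC_scaleC scaleC_add_left)
  also have "of_real r * \<i> + (-1) * cnj (of_real r * \<i>) = 2 * of_real r * \<i>"
    by simp
  finally show ?thesis .
qed

text \<open>
  For \<open>n \<ge> 3\<close> the tuple \<open>(\<i> 1, 1, \<dots>, 1, x', y)\<close> evaluates to \<open>[c x', y]\<^sub>*\<close> with a nonzero
  scalar \<open>c\<close>. Unitality and homogeneity make \<open>\<phi>\<close> map this tuple to one of the same
  shape, and \<open>x' = c\<inverse> x\<close> absorbs the scalar on both sides.
\<close>

lemma multiplicative_star_lie_map_binary:
  assumes n: "n \<ge> 2"
    and one: "\<phi> 1 = 1"
    and scale: "\<And>a A. \<phi> (a *\<^sub>C A) = a *\<^sub>C \<phi> A"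
    and mult: "multiplicative_star_lie_map n \<phi>"
  shows "\<phi> (star_lie_product x y) = star_lie_product (\<phi> x) (\<phi> y)"
proof (cases "n = 2")
  case True
  have "\<phi> (star_lie_poly n (\<lambda>i. if i = 1 then x else y))
      = star_lie_poly n (\<lambda>i. \<phi> (if i = 1 then x else y))"
    using mult by (simp add: multiplicative_star_lie_map_def)
  then show ?thesis using True by (simp add: numeral_2_eq_2)
next
  case False
  define m where "m = n - 3"
  have n_eq: "n = Suc (Suc (Suc m))" using n False by (simp add: m_def)
  define c :: complex where "c = 2 * of_real (2 ^ m) * \<i>"
  have c: "c \<noteq> 0" by (simp add: c_def)
  define x' where "x' = (inverse c) *\<^sub>C x"
  define t where "t i = (if i = 1 then \<i> *\<^sub>C 1 else if i = Suc (Suc m) then x'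
    else if i = n then y else 1)" for i
  have poly_t: "star_lie_poly (Suc m) t = (2 ^ m * \<i>) *\<^sub>C 1"
    by (rule star_lie_poly_imaginary_unit) (auto simp: t_def n_eq)
  have poly_\<phi>t: "star_lie_poly (Suc m) (\<lambda>i. \<phi> (t i)) = (2 ^ m * \<i>) *\<^sub>C 1"
    by (rule star_lie_poly_imaginary_unit) (auto simp: t_def n_eq one scale)
  have cx: "c *\<^sub>C x' = x" and c\<phi>x: "c *\<^sub>C \<phi> x' = \<phi> x"
    using c by (simp_all add: x'_def scale scaleC_scaleC scaleC_one)
  have "star_lie_poly n t
      = star_lie_product (star_lie_product ((of_real (2 ^ m) * \<i>) *\<^sub>C 1) x') y"
    using poly_t by (simp add: n_eq t_def)
  also have "\<dots> = star_lie_product x y"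
    by (simp only: star_lie_product_scalar c_def[symmetric] cx)
  finally have left: "star_lie_poly n t = star_lie_product x y" .
  have "star_lie_poly n (\<lambda>i. \<phi> (t i))
      = star_lie_product (star_lie_product ((of_real (2 ^ m) * \<i>) *\<^sub>C 1) (\<phi> x')) (\<phi> y)"
    using poly_\<phi>t by (simp add: n_eq t_def)
  also have "\<dots> = star_lie_product (\<phi> x) (\<phi> y)"
    by (simp only: star_lie_product_scalar c_def[symmetric] c\<phi>x)
  finally have right: "star_lie_poly n (\<lambda>i. \<phi> (t i)) = star_lie_product (\<phi> x) (\<phi> y)" .
  have "\<phi> (star_lie_poly n t) = star_lie_poly n (\<lambda>i. \<phi> (t i))"
    by (rule mult[unfolded multiplicative_star_lie_map_def, THEN spec])
  then show ?thesis by (simp only: left right)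
qed

section \<open>Lie and Jordan products with self-adjoint elements\<close>

locale star_lie_bijection =
  fixes \<phi> :: "'a::unital_cstar_algebra \<Rightarrow> 'b::unital_cstar_algebra"
  assumes bij: "bij \<phi>"
    and one [simp]: "\<phi> 1 = 1"
    and scale: "\<phi> (a *\<^sub>C x) = a *\<^sub>C \<phi> x"
    and lie: "\<phi> (x * y - y * star x) = \<phi> x * \<phi> y - \<phi> y * star (\<phi> x)"
begin

lemma eq_iff [simp]: "\<phi> x = \<phi> y \<longleftrightarrow> x = y"
  using bij by (simp add: bij_def inj_eq)

lemma preimage: obtains x where "\<phi> x = y"
  using bij by (metis bij_pointE)

lemma zero [simp]: "\<phi> 0 = 0"
  using lie[of 1 1] by simp

lemma minus [simp]: "\<phi> (- x) = - \<phi> x"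
  using scale[of "-1" x] by (simp add: scaleC_minus_one)

lemma double [simp]: "\<phi> (x + x) = \<phi> x + \<phi> x"
  using scale[of 2 x] scaleC_add_left[of 1 1 x] scaleC_add_left[of 1 1 "\<phi> x"]
  by (simp add: scaleC_one)

text \<open>
  Since the star is conjugate-linear, replacing \<open>x\<close> by \<open>\<i> x\<close> flips the sign between the two terms
  of \<open>lie\<close>; homogeneity lets the factor \<open>\<i>\<close> be cancelled afterwards.
\<close>

lemma jordan: "\<phi> (x * y + y * star x) = \<phi> x * \<phi> y + \<phi> y * star (\<phi> x)"
proof -
  have expand: "(\<i> *\<^sub>C u) * v - v * star (\<i> *\<^sub>C u) = \<i> *\<^sub>C (u * v + v * star u)"
    for u v :: "'c::unital_cstar_algebra"
  proof -
    have "v * star (\<i> *\<^sub>C u) = (-1) *\<^sub>C (\<i> *\<^sub>C (v * star u))"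
      by (simp add: star_scaleC mult_scaleC_right scaleC_scaleC)
    then show ?thesis
      by (simp add: scaleC_minus_one mult_scaleC_left scaleC_add_right)
  qed
  have "\<i> *\<^sub>C \<phi> (x * y + y * star x) = \<i> *\<^sub>C (\<phi> x * \<phi> y + \<phi> y * star (\<phi> x))"
    using lie[of "\<i> *\<^sub>C x" y] unfolding scale expand .
  then have "(- \<i>) *\<^sub>C (\<i> *\<^sub>C \<phi> (x * y + y * star x))
      = (- \<i>) *\<^sub>C (\<i> *\<^sub>C (\<phi> x * \<phi> y + \<phi> y * star (\<phi> x)))"
    by simp
  then show ?thesis by (simp add: scaleC_scaleC scaleC_one)
qed

lemma self_adjoint:
  assumes "star x = x"
  shows "star (\<phi> x) = \<phi> x"
  using jordan[of x 1] assms by simp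

lemma lie_self_adjoint:
  assumes "star x = x"
  shows "\<phi> (x * y - y * x) = \<phi> x * \<phi> y - \<phi> y * \<phi> x"
  using lie[of x y] assms by (simp add: self_adjoint)

lemma jordan_self_adjoint:
  assumes "star x = x"
  shows "\<phi> (x * y + y * x) = \<phi> x * \<phi> y + \<phi> y * \<phi> x"
  using jordan[of x y] assms by (simp add: self_adjoint)

lemma projection:
  assumes "symmetric_projection p"
  shows "symmetric_projection (\<phi> p)"
  using jordan_self_adjoint[of p p] symmetric_projectionD[OF assms]
  by (simp add: symmetric_projection_def self_adjoint double_cancel)

section \<open>Additivity across the Peirce corners\<close>

text \<open>
  The next three lemmas let a preimage \<open>t\<close> of \<open>\<phi> a + \<phi> b\<close> be tested against an element of choice.
  When the test element kills the contribution of \<open>a\<close> or of \<open>b\<close>, the right-hand side collapses to a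
  single value of \<open>\<phi>\<close> and injectivity applies.
\<close>

lemma lie_sum:
  assumes "\<phi> t = \<phi> a + \<phi> b" "star x = x"
  shows "\<phi> (x * t - t * x) = \<phi> (x * a - a * x) + \<phi> (x * b - b * x)"
  using assms by (simp add: lie_self_adjoint algebra_simps)

lemma jordan_sum:
  assumes "\<phi> t = \<phi> a + \<phi> b"
  shows "\<phi> (x * t + t * star x) = \<phi> (x * a + a * star x) + \<phi> (x * b + b * star x)"
  using assms by (simp add: jordan algebra_simps)

lemma jordan_sum_left:
  assumes "\<phi> t = \<phi> a + \<phi> b"
  shows "\<phi> (t * y + y * star t) = \<phi> (a * y + y * star a) + \<phi> (b * y + y * star b)"
  using assms by (simp add: jordan star_add algebra_simps)

text \<open>
  The Jordan product with \<open>p\<close> kills \<open>b\<close> and doubles \<open>a\<close>, the one with \<open>1 - p\<close> does the opposite,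
  and the two Jordan products of \<open>t\<close> add up to \<open>2 t\<close>.
\<close>

lemma add_diagonal:
  assumes p: "symmetric_projection p"
    and pa: "p * a = a" "a * p = a" and pb: "p * b = 0" "b * p = 0"
  shows "\<phi> (a + b) = \<phi> a + \<phi> b"
proof -
  note P = symmetric_projectionD[OF p]
  obtain t where t: "\<phi> t = \<phi> a + \<phi> b" by (rule preimage)
  have ta: "p * t + t * p = a + a"
    using jordan_sum[OF t, of p] by (simp add: P(3) pa pb flip: double)
  have tb: "(1 - p) * t + t * (1 - p) = b + b"
    using jordan_sum[OF t, of "1 - p"]
    by (simp add: P(3) star_diff algebra_simps pa pb flip: double)
  have "t + t = (a + b) + (a + b)"
    using ta tb by (simp add: algebra_simps)
  then have "t = a + b" by (simp only: double_cancel)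
  then show ?thesis using t by simp
qed

lemma compl:
  assumes p: "symmetric_projection p"
  shows "\<phi> (1 - p) = 1 - \<phi> p"
proof -
  have "\<phi> (p + (1 - p)) = \<phi> p + \<phi> (1 - p)"
    by (rule add_diagonal[OF p]) (simp_all add: algebra_simps symmetric_projectionD[OF p])
  then show ?thesis by (simp add: algebra_simps)
qed

text \<open>
  The Jordan product with \<open>p\<close> fixes both corners, so \<open>t\<close> is off-diagonal. It does not tell \<open>a\<close>
  from \<open>b\<close>; that is done by putting the projection on the right, where \<open>a p = 0\<close> and
  \<open>b (1 - p) = 0\<close>.
\<close>

lemma add_off_diagonal:
  assumes p: "symmetric_projection p"
    and pa: "p * a = a" "a * p = 0" and pb: "p * b = 0" "b * p = b"
  shows "\<phi> (a + b) = \<phi> a + \<phi> b"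
proof -
  note P = symmetric_projectionD[OF p]
  obtain t where t: "\<phi> t = \<phi> a + \<phi> b" by (rule preimage)
  have "p * star b = star (b * p)" "star b * p = star (p * b)"
       "p * star a = star (a * p)" "star a * p = star (p * a)"
    by (simp_all add: star_mult P(3))
  then have pstar: "p * star b = star b" "star b * p = 0" "p * star a = 0" "star a * p = star a"
    by (simp_all add: pa pb)
  have "\<phi> (p * t + t * p) = \<phi> t"
    using jordan_sum[OF t, of p] by (simp add: P(3) pa pb t)
  then have off: "p * t + t * p = t" by simp
  have "\<phi> (t * p + p * star t) = \<phi> (b + star b)"
    using jordan_sum_left[OF t, of p] by (simp add: pa pb pstar)
  then have "t * p + p * star t = b + star b" by simp
  then have "(t * p + p * star t) * p = (b + star b) * p" by simp
  moreover have "p * t * p = 0"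
    using arg_cong[OF off, of "\<lambda>z. p * z"] by (simp add: algebra_simps P)
  then have "star (p * t * p) = 0" by simp
  then have "p * (star t * p) = 0" by (simp add: star_mult P(3))
  ultimately have tb: "t * p = b"
    by (simp add: distrib_right mult.assoc P pb pstar)
  have "\<phi> (t * (1 - p) + (1 - p) * star t) = \<phi> (a + star a)"
    using jordan_sum_left[OF t, of "1 - p"] by (simp add: algebra_simps pa pb pstar)
  then have "t * (1 - p) + (1 - p) * star t = a + star a" by simp
  then have "p * (t * (1 - p) + (1 - p) * star t) = p * (a + star a)" by simp
  then have "p * t = a"
    using \<open>p * t * p = 0\<close> by (simp add: algebra_simps P pa pstar)
  then have "t = a + b" using off tb by simp
  then show ?thesis using t by simp
qed

text \<open>
  The commutator with \<open>p\<close> sends \<open>x\<close> to \<open>u + v\<close> with \<open>u = p x (1 - p)\<close> and \<open>v = - (1 - p) x p\<close>, and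
  \<open>u\<close> and \<open>v\<close> are eigenvectors of this commutator for the eigenvalues \<open>1\<close> and \<open>-1\<close>. The eigenvalue
  equations carry over to \<open>\<phi> u\<close> and \<open>\<phi> v\<close> and place them in the off-diagonal corners of \<open>\<phi> p\<close>, so
  \<open>\<phi> u\<close> is the upper corner of the commutator of \<open>\<phi> p\<close> with \<open>\<phi> x\<close>.
\<close>

lemma off_diagonal_corner:
  assumes p: "symmetric_projection p"
  shows "\<phi> (p * x * (1 - p)) = \<phi> p * \<phi> x * (1 - \<phi> p)"
proof -
  note P = symmetric_projectionD[OF p]
  note Q = symmetric_projectionD[OF projection[OF p]]
  define u where "u = p * x * (1 - p)"
  define v where "v = - ((1 - p) * x * p)"
  have absorb: "p * u = u" "u * p = 0" "p * v = 0" "v * p = v"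
    by (simp_all add: u_def v_def algebra_simps P)
  have sum: "\<phi> u + \<phi> v = \<phi> p * \<phi> x - \<phi> x * \<phi> p"
  proof -
    have "u + v = p * x - x * p" by (simp add: u_def v_def algebra_simps)
    then show ?thesis
      using add_off_diagonal[OF p absorb] lie_self_adjoint[OF P(3), of x] by simp
  qed
  have u0: "\<phi> p * \<phi> u - \<phi> u * \<phi> p - \<phi> u = 0" and v0: "\<phi> p * \<phi> v - \<phi> v * \<phi> p + \<phi> v = 0"
    by (simp_all add: absorb flip: lie_self_adjoint[OF P(3)])
  have "\<phi> p * (\<phi> u * \<phi> p) = - (\<phi> p * (\<phi> p * \<phi> u - \<phi> u * \<phi> p - \<phi> u))"
    by (simp add: algebra_simps Q)
  then have pup: "\<phi> p * (\<phi> u * \<phi> p) = 0" by (simp only: u0) simp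
  have "\<phi> u * \<phi> p + \<phi> u * \<phi> p
      = \<phi> p * (\<phi> u * \<phi> p) - (\<phi> p * \<phi> u - \<phi> u * \<phi> p - \<phi> u) * \<phi> p"
    by (simp add: algebra_simps Q)
  also have "\<dots> = 0 + 0" by (simp only: u0 pup) simp
  finally have up: "\<phi> u * \<phi> p = 0" by (simp only: double_cancel)
  have "\<phi> p * (\<phi> v * \<phi> p) = (\<phi> p * \<phi> v - \<phi> v * \<phi> p + \<phi> v) * \<phi> p"
    by (simp add: algebra_simps Q)
  then have pvp: "\<phi> p * (\<phi> v * \<phi> p) = 0" by (simp only: v0) simp
  have "\<phi> p * \<phi> v + \<phi> p * \<phi> v
      = \<phi> p * (\<phi> v * \<phi> p) + \<phi> p * (\<phi> p * \<phi> v - \<phi> v * \<phi> p + \<phi> v)"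
    by (simp add: algebra_simps Q)
  also have "\<dots> = 0 + 0" by (simp only: v0 pvp) simp
  finally have pv: "\<phi> p * \<phi> v = 0" by (simp only: double_cancel)
  have "\<phi> u = \<phi> p * (\<phi> u + \<phi> v) * (1 - \<phi> p)"
    using u0 by (simp add: algebra_simps up pv pvp)
  also have "\<dots> = \<phi> p * \<phi> x * (1 - \<phi> p)"
    unfolding sum by (simp add: algebra_simps Q)
  finally show ?thesis by (simp only: u_def)
qed

text \<open>
  The reflection \<open>p - (1 - p) = 2 p - 1\<close> commutes with diagonal elements and anticommutes with
  off-diagonal ones. Its Jordan product with \<open>t\<close> sees only \<open>a\<close>, whereas the commutator of \<open>p\<close> with
  \<open>t\<close> sees only \<open>b\<close>. The error \<open>d = t - a - b\<close> hence both commutes and anticommutes with the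
  reflection, whose square is \<open>1\<close>, so \<open>d\<close> vanishes.
\<close>

lemma add_diagonal_off_diagonal:
  assumes p: "symmetric_projection p"
    and a: "p * a = a * p" and b: "p * b + b * p = b"
  shows "\<phi> (a + b) = \<phi> a + \<phi> b"
proof -
  note P = symmetric_projectionD[OF p]
  obtain t where t: "\<phi> t = \<phi> a + \<phi> b" by (rule preimage)
  have u: "star (p + p - 1) = p + p - 1" by (simp add: star_simps P)
  have "\<phi> ((p + p - 1) * t + t * (p + p - 1)) = \<phi> ((p + p - 1) * a + a * (p + p - 1))"
  proof -
    have "(p + p - 1) * b + b * (p + p - 1) = (p * b + b * p) + (p * b + b * p) - b - b"
      by (simp add: algebra_simps)
    then have "(p + p - 1) * b + b * (p + p - 1) = 0" by (simp add: b)
    then show ?thesis using jordan_sum[OF t, of "p + p - 1"] by (simp only: u zero add_0_right)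
  qed
  then have diag: "(p + p - 1) * t + t * (p + p - 1) = (p + p - 1) * a + a * (p + p - 1)"
    by simp
  have "\<phi> (p * t - t * p) = \<phi> (p * b - b * p)"
    using lie_sum[OF t P(3)] a by simp
  then have off: "p * t - t * p = p * b - b * p" by simp
  define d where "d = t - a - b"
  have comm: "p * d = d * p"
    using off a by (simp add: d_def algebra_simps)
  have anti: "(p + p - 1) * d + d * (p + p - 1) = 0"
  proof -
    have "(p + p - 1) * d + d * (p + p - 1) = ((p + p - 1) * t + t * (p + p - 1))
       - ((p + p - 1) * a + a * (p + p - 1)) - ((p * b + b * p) + (p * b + b * p) - b - b)"
      by (simp add: d_def algebra_simps)
    then show ?thesis by (simp add: diag b)
  qed
  \<comment> \<open>Twice the product with the reflection is the sum of the commutator and the Jordan product.\<close>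
  have "(p + p - 1) * d = d * (p + p - 1)" by (simp add: algebra_simps comm)
  then have "(p + p - 1) * d + (p + p - 1) * d = 0 + 0" using anti by simp
  then have "(p + p - 1) * d = 0" by (simp only: double_cancel)
  then have "(p + p - 1) * ((p + p - 1) * d) = 0" by simp
  then have "d = 0" by (simp add: algebra_simps P)
  then have "t = a + b" by (simp add: d_def algebra_simps)
  then show ?thesis using t by simp
qed

lemma peirce_decomposition:
  assumes p: "symmetric_projection p"
  shows "\<phi> x = \<phi> (p * x * p) + \<phi> ((1 - p) * x * (1 - p))
    + \<phi> (p * x * (1 - p)) + \<phi> ((1 - p) * x * p)"
proof -
  note P = symmetric_projectionD[OF p]
  have "x = (p * x * p + (1 - p) * x * (1 - p)) + (p * x * (1 - p) + (1 - p) * x * p)"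
    by (simp add: algebra_simps)
  then have "\<phi> x = \<phi> \<dots>" by simp
  also have "\<dots> = \<phi> (p * x * p + (1 - p) * x * (1 - p)) + \<phi> (p * x * (1 - p) + (1 - p) * x * p)"
    by (rule add_diagonal_off_diagonal[OF p]) (simp_all add: algebra_simps P)
  also have "\<phi> (p * x * p + (1 - p) * x * (1 - p)) = \<phi> (p * x * p) + \<phi> ((1 - p) * x * (1 - p))"
    by (rule add_diagonal[OF p]) (simp_all add: algebra_simps P)
  also have "\<phi> (p * x * (1 - p) + (1 - p) * x * p) = \<phi> (p * x * (1 - p)) + \<phi> ((1 - p) * x * p)"
    by (rule add_off_diagonal[OF p]) (simp_all add: algebra_simps P)
  finally show ?thesis by (simp add: add.assoc)
qed

section \<open>Additivity inside the Peirce corners\<close>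

text \<open>
  With \<open>q = 1 - p\<close>, the element \<open>(p + a) (q + b) + (q + b) (p + a)\<^sup>*\<close> equals \<open>a + b + a\<^sup>* + b a\<^sup>*\<close>,
  whose corner in \<open>p A q\<close> is \<open>a + b\<close>. Additivity across corners expands \<open>\<phi> (p + a)\<close> and
  \<open>\<phi> (q + b)\<close>, and the same computation among the images has corner \<open>\<phi> a + \<phi> b\<close>.
\<close>

lemma add_off_diagonal_corner:
  assumes p: "symmetric_projection p"
    and pa: "p * a = a" "a * p = 0" and pb: "p * b = b" "b * p = 0"
  shows "\<phi> (a + b) = \<phi> a + \<phi> b"
proof -
  note P = symmetric_projectionD[OF p]
  note Q = symmetric_projectionD[OF projection[OF p]]
  have corner: "\<phi> p * \<phi> c = \<phi> c" "\<phi> c * \<phi> p = 0" if "p * c = c" "c * p = 0" for c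
  proof -
    have "p * c * (1 - p) = c" using that by (simp add: algebra_simps)
    then have "\<phi> c = \<phi> p * \<phi> c * (1 - \<phi> p)"
      using off_diagonal_corner[OF p, of c] by (simp only:)
    from off_diagonal_absorb[OF projection[OF p] this]
    show "\<phi> p * \<phi> c = \<phi> c" "\<phi> c * \<phi> p = 0" .
  qed
  note A = corner[OF pa] and B = corner[OF pb]
  have "star (\<phi> a) * \<phi> p = star (\<phi> p * \<phi> a)" "\<phi> p * star (\<phi> a) = star (\<phi> a * \<phi> p)"
    by (simp_all add: star_mult Q)
  then have As: "star (\<phi> a) * \<phi> p = star (\<phi> a)" "\<phi> p * star (\<phi> a) = 0" by (simp_all add: A)
  have "star a * p = star (p * a)" "p * star a = star (a * p)"
    by (simp_all add: star_mult P)
  then have as: "star a * p = star a" "p * star a = 0" by (simp_all add: pa)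
  have ab: "a * b = 0" "\<phi> a * \<phi> b = 0"
    by (metis pa(2) pb(1) mult.assoc mult_zero_left, metis A(2) B(1) mult.assoc mult_zero_left)
  let ?x = "p + a" and ?y = "(1 - p) + b"
  have x: "\<phi> ?x = \<phi> p + \<phi> a"
    by (rule add_diagonal_off_diagonal[OF p]) (simp_all add: pa)
  have y: "\<phi> ?y = (1 - \<phi> p) + \<phi> b"
    unfolding compl[OF p, symmetric]
    by (rule add_diagonal_off_diagonal[OF p]) (simp_all add: pb algebra_simps)
  have "p * (?x * ?y + ?y * star ?x) * (1 - p) = a + b"
    by (simp add: algebra_simps star_simps P pa pb as ab)
  then have "\<phi> (a + b) = \<phi> (p * (?x * ?y + ?y * star ?x) * (1 - p))" by simp
  also have "\<dots> = \<phi> p * (\<phi> ?x * \<phi> ?y + \<phi> ?y * star (\<phi> ?x)) * (1 - \<phi> p)"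
    unfolding off_diagonal_corner[OF p] jordan ..
  also have "\<dots> = \<phi> a + \<phi> b"
    unfolding x y by (simp add: algebra_simps star_simps Q A B As ab)
  finally show ?thesis .
qed

text \<open>
  For \<open>x\<close> in \<open>q A p\<close> with \<open>q = 1 - p\<close>, and \<open>c\<close> in \<open>p A p\<close>, the product \<open>x c + c x\<^sup>*\<close> has the corner
  \<open>x c\<close> in \<open>q A p\<close>. Testing \<open>t\<close> against all such \<open>x\<close> and using additivity inside \<open>q A p\<close> gives
  \<open>x t = x (a + b)\<close>, and faithfulness cancels \<open>x\<close>.
\<close>

lemma add_diagonal_corner:
  assumes p: "symmetric_projection p"
    and faithful: "\<And>x. (\<And>z. (1 - p) * z * x = 0) \<Longrightarrow> x = 0"
    and pa: "p * a = a" "a * p = a" and pb: "p * b = b" "b * p = b"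
  shows "\<phi> (a + b) = \<phi> a + \<phi> b"
proof -
  note P = symmetric_projectionD[OF p]
  let ?q = "1 - p"
  have q: "symmetric_projection ?q" by (rule symmetric_projection_compl[OF p])
  obtain t where t: "\<phi> t = \<phi> a + \<phi> b" by (rule preimage)
  \<comment> \<open>The Jordan product with \<open>1 - p\<close> annihilates \<open>a\<close> and \<open>b\<close>, hence \<open>t\<close>, which places \<open>t\<close> in
     the corner of \<open>p\<close>.\<close>
  have "\<phi> (?q * t + t * ?q) = \<phi> 0"
    using jordan_sum[OF t, of ?q] by (simp add: star_diff P algebra_simps pa pb)
  then have anti: "?q * t + t * ?q = 0" by (simp only: eq_iff)
  have "p * t * ?q = 0" "?q * t * p = 0"
    using arg_cong[OF anti, of "\<lambda>z. p * z"] arg_cong[OF anti, of "\<lambda>z. z * p"]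
    by (simp_all add: algebra_simps P)
  then have "p * t = p * t * p" "t * p = p * t * p"
    by (simp_all add: left_diff_distrib right_diff_distrib)
  then have comm: "p * t = t * p" by metis
  have "t + t = p * t + t * p"
    using anti by (simp add: algebra_simps)
  then have pt: "t * p = t"
    unfolding comm by (simp add: double_cancel)
  then have pt: "p * t = t" "t * p = t"
    using comm by simp_all
  have corner: "?q * (x * c + c * star x) * (1 - ?q) = x * c"
    if "x = ?q * z * p" "p * c = c" "c * p = c" for x z c
  proof -
    have "?q * x = x"
      unfolding that(1) by (simp add: algebra_simps P)
    moreover have "?q * c = 0"
      using that(2) by (simp add: algebra_simps)
    moreover have "?q * (x * c + c * star x) * (1 - ?q)
        = (?q * x) * (c * p) + (?q * c) * (star x * p)"
      by (simp add: distrib_left distrib_right mult.assoc)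
    ultimately show ?thesis using that(3) by simp
  qed
  have "?q * z * (t - (a + b)) = 0" for z
  proof -
    define x where "x = ?q * z * p"
    have "\<phi> (x * t) = \<phi> (?q * (x * t + t * star x) * (1 - ?q))"
      by (simp only: corner[OF x_def pt])
    also have "\<dots> = \<phi> (?q * (x * a + a * star x) * (1 - ?q))
        + \<phi> (?q * (x * b + b * star x) * (1 - ?q))"
      unfolding off_diagonal_corner[OF q] jordan_sum[OF t] by (simp only: distrib_left distrib_right)
    also have "\<dots> = \<phi> (x * a) + \<phi> (x * b)"
      by (simp only: corner[OF x_def pa] corner[OF x_def pb])
    also have "\<dots> = \<phi> (x * a + x * b)"
      by (rule add_off_diagonal_corner[OF q, symmetric])
        (simp_all add: x_def algebra_simps P pa pb)
    finally have "x * t = x * a + x * b" by simp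
    then show ?thesis by (simp add: x_def algebra_simps pt pa pb)
  qed
  then have "t - (a + b) = 0" by (rule faithful)
  then show ?thesis using t by simp
qed

section \<open>From additivity to multiplicativity\<close>

lemma additive:
  fixes p :: 'a
  assumes p: "symmetric_projection p"
    and faithful: "\<And>x. (\<And>z. p * z * x = 0) \<Longrightarrow> x = 0"
      "\<And>x. (\<And>z. (1 - p) * z * x = 0) \<Longrightarrow> x = 0"
  shows "\<phi> (x + y) = \<phi> x + \<phi> y"
proof -
  note P = symmetric_projectionD[OF p]
  let ?q = "1 - p"
  have q: "symmetric_projection ?q" by (rule symmetric_projection_compl[OF p])
  \<comment> \<open>The label \<open>ij\<close> refers to the corner of \<open>p\<^sub>i\<close> and \<open>p\<^sub>j\<close> with \<open>p\<^sub>1 = p\<close> and \<open>p\<^sub>2 = 1 - p\<close>.\<close>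
  have 11: "\<phi> (p * (x + y) * p) = \<phi> (p * x * p) + \<phi> (p * y * p)"
    unfolding distrib_left distrib_right
    by (rule add_diagonal_corner[OF p faithful(2)]) (simp_all add: mult.assoc P)
  have 22: "\<phi> (?q * (x + y) * ?q) = \<phi> (?q * x * ?q) + \<phi> (?q * y * ?q)"
    unfolding distrib_left distrib_right
    by (rule add_diagonal_corner[OF q]) (simp_all add: faithful(1) algebra_simps P)
  have 12: "\<phi> (p * (x + y) * ?q) = \<phi> (p * x * ?q) + \<phi> (p * y * ?q)"
    unfolding distrib_left distrib_right
    by (rule add_off_diagonal_corner[OF p]) (simp_all add: algebra_simps P)
  have 21: "\<phi> (?q * (x + y) * p) = \<phi> (?q * x * p) + \<phi> (?q * y * p)"
    unfolding distrib_left distrib_right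
    by (rule add_off_diagonal_corner[OF q]) (simp_all add: algebra_simps P)
  show ?thesis
    unfolding peirce_decomposition[OF p, of "x + y"] peirce_decomposition[OF p, of x]
      peirce_decomposition[OF p, of y] 11 22 12 21
    by (simp only: add_ac)
qed

lemma star_isomorphism_if_additive:
  assumes add: "\<And>x y. \<phi> (x + y) = \<phi> x + \<phi> y"
  shows "star_isomorphism \<phi>"
proof -
  have "\<phi> (x * y) = \<phi> x * \<phi> y" for x y
  proof -
    have "\<phi> (x * y) + \<phi> (x * y) = \<phi> ((x * y + y * star x) + (x * y - y * star x))"
      by (simp flip: double)
    also have "\<dots> = \<phi> x * \<phi> y + \<phi> x * \<phi> y"
      unfolding add[of "x * y + y * star x"] jordan lie by simp
    finally show ?thesis by (simp only: double_cancel)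
  qed
  moreover have "\<phi> (star x) = star (\<phi> x)" for x
    using jordan[of x 1] add[of x "star x"] by simp
  ultimately show ?thesis
    by (simp add: star_isomorphism_def bij add scale)
qed

end

section \<open>The equivalence\<close>

lemma star_isomorphism_star_lie_poly:
  assumes "star_isomorphism \<phi>"
  shows "\<phi> (star_lie_poly n x) = star_lie_poly n (\<lambda>i. \<phi> (x i))"
proof -
  have add: "\<phi> (x + y) = \<phi> x + \<phi> y" and mult: "\<phi> (x * y) = \<phi> x * \<phi> y"
    and star: "\<phi> (star x) = star (\<phi> x)" for x y
    using assms by (auto simp: star_isomorphism_def)
  have zero: "\<phi> 0 = 0" using add[of 0 0] by simp
  have diff: "\<phi> (x - y) = \<phi> x - \<phi> y" for x y using add[of "x - y" y] by (simp add: algebra_simps)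
  show ?thesis
    by (induction n x rule: star_lie_poly.induct)
      (simp_all add: zero star_lie_product_def diff mult star)
qed

theorem corollary3p1:
  fixes n :: nat
    and P1 P2 :: "'a::unital_cstar_algebra"
    and \<phi> :: "'a \<Rightarrow> 'b::unital_cstar_algebra"
  assumes "n \<ge> 2"
    and "nontrivial_symmetric_projection P1"
    and "P2 = 1 - P1"
    and "nontrivial_symmetric_projection P2"
    and "\<forall>P\<in>{P1, P2}. \<forall>X. range (\<lambda>A. P * A * X) = {0} \<longrightarrow> X = 0"
    and "bij \<phi>"
    and "\<phi> 1 = 1"
    and "\<forall>a A. \<phi> (a *\<^sub>C A) = a *\<^sub>C \<phi> A"
    and "\<forall>P\<in>{P1, P2}. \<forall>Y. range (\<lambda>B. \<phi> P * B * Y) = {0} \<longrightarrow> Y = 0"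
  shows "multiplicative_star_lie_map n \<phi> \<longleftrightarrow> star_isomorphism \<phi>"
proof
  assume "multiplicative_star_lie_map n \<phi>"
  then have "\<phi> (star_lie_product x y) = star_lie_product (\<phi> x) (\<phi> y)" for x y
    using assms(1,7,8) by (intro multiplicative_star_lie_map_binary) auto
  then interpret star_lie_bijection \<phi>
    using assms(6-8) by unfold_locales (auto simp: star_lie_product_def)
  have P1: "symmetric_projection P1"
    using assms(2) by (simp add: nontrivial_symmetric_projection_def)
  have faithful: "X = 0" if "P \<in> {P1, P2}" "\<And>A. P * A * X = 0" for P X
    using assms(5) that by auto
  show "star_isomorphism \<phi>"
    by (rule star_isomorphism_if_additive, rule additive[OF P1])
      (use faithful assms(3) in auto)
next
  assume "star_isomorphism \<phi>"
  then show "multiplicative_star_lie_map n \<phi>"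
    by (simp add: multiplicative_star_lie_map_def star_isomorphism_star_lie_poly)
qed

end
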